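(* Consider the control system $$\Sigma:\quad \dot\eta=f(\eta,\zeta),\qquad \dot\zeta=\upsilon,$$ with state $(\eta,\zeta)\in\mathbb{R}^{n_\eta}\times\mathbb{R}^{n_\zeta}$ and control input $\upsilon$, and assume the function $f$ is smooth. Suppose there exists a continuously differentiable function $\psi:\mathbb{R}^{n_\eta}\to\mathbb{R}^{n_\zeta}$ such that the metric $\widehat G:\mathbb{R}^{n_\eta}\to\mathbb{R}^{n_\eta\times n_\eta}$ is a contraction metric, with respect to states and inputs, for the control system $$\Sigma_\eta:\quad \dot\eta=f(\eta,\psi(\eta)+\widetilde\upsilon)$$ with input $\widetilde\upsilon$, satisfying the defining inequality of a contraction metric with respect to states and inputs with constants $\widehat\lambda\in\mathbb{R}^+$ and $\alpha\in\mathbb{R}_0^+$. Then $$\widetilde G(x)=\begin{bmatrix}\widehat G(y)+\left(\frac{\partial\psi}{\partial y}\right)^T\frac{\partial\psi}{\partial y}&-\left(\frac{\partial\psi}{\partial y}\right)^T\\-\frac{\partial\psi}{\partial y}&I_{n_\zeta}\end{bmatrix},\qquad x=[y^T,z^T]^T,$$ is a contraction metric, with respect to states and inputs, for $\Sigma$ equipped with the state feedback control law $$\upsilon=k(\eta,\zeta,\widehat\upsilon)=-\lambda(\zeta-\psi(\eta))+\frac{\partial\psi}{\partial y}(\eta)f(\eta,\zeta)+\widehat\upsilon$$ (i.e. for the resulting closed-loop system with input $\widehat\upsilon$), for all $\lambda>\frac{\alpha^2}{8\widehat\lambda}$.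
   Context: Here $\frac{\partial\psi}{\partial y}$ is the Jacobian of $\psi$ and $I_k$ is the $k\times k$ identity matrix. The inputs $\upsilon,\widetilde\upsilon,\widehat\upsilon$ take values in $\mathbb{R}^{n_\zeta}$. A function is smooth if it is infinitely differentiable. Control systems. A control system is a quadruple $(\mathbb{R}^n,\mathsf{U},\mathcal{U},h)$ where $\mathbb{R}^n$ is the state space; $\mathsf{U}\subseteq\mathbb{R}^m$ is the input set; $\mathcal{U}$ is the set of all measurable, locally essentially bounded functions of time from intervals $]a,b[\subseteq\mathbb{R}$, with $a<0<b$, to $\mathsf{U}$; and $h:\mathbb{R}^n\times\mathsf{U}\to\mathbb{R}^n$ is continuous and such that for every compact $Q\subset\mathbb{R}^n$ there is $Z>0$ with $\|h(x,u)-h(y,u)\|\le Z\|x-y\|$ for all $x,y\in Q$, $u\in\mathsf{U}$. It is smooth if $h$ is smooth. Contraction metrics. A Riemannian metric on $\mathbb{R}^n$ is a smooth map $G:\mathbb{R}^n\to\mathbb{R}^{n\times n}$ with $G(x)$ symmetric positive definite for every $x$. Write $\langle I,J\rangle_H=I^THJ$ for any matrix $H$. For a smooth control system $(\mathbb{R}^n,\mathsf{U},\mathcal{U},h)$ with $\mathsf{U}\subseteq\mathbb{R}^m$, a Riemannian metric $G$ is a contraction metric, with respect to states and inputs, if there exist constants $\widehat\lambda\in\mathbb{R}^+$ and $\alpha\in\mathbb{R}_0^+$ such that $$\langle X,X\rangle_F+2\left\langle\frac{\partial h}{\partial u}Y,X\right\rangle_G\le-\widehat\lambda\langle X,X\rangle_G+\alpha\langle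 X,X\rangle_G^{1/2}\langle Y,Y\rangle_{I_m}^{1/2}$$ for all $X,x\in\mathbb{R}^n$, $u\in\mathsf{U}$, $Y\in\mathbb{R}^m$, where $F(x,u)=\left(\frac{\partial h}{\partial x}\right)^TG(x)+G(x)\frac{\partial h}{\partial x}+\frac{\partial G}{\partial x}h(x,u)$ and $\frac{\partial G}{\partial x}h$ is the matrix with entries $\sum_k\frac{\partial G_{ij}}{\partial x_k}h_k$.
   Formalization: ψ is assumed smooth rather than only continuously differentiable: the block −∂ψ/∂y of G̃ must be smooth for G̃ to be a Riemannian metric, and with f = −y, ψ = y|y|, Ĝ = 1 the claim fails for a C¹ function ψ. *)

theory Defs
  imports "HOL-Analysis.Analysis"
begin

section \<open>Smooth functions\<close>

text \<open>On an open subset of a Euclidean space, being k times continuously differentiable means that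
  all iterated directional derivatives up to order k exist and are continuous.\<close>

primrec Ck_on :: "nat \<Rightarrow> ('a::euclidean_space \<Rightarrow> 'b::real_normed_vector) \<Rightarrow> 'a set \<Rightarrow> bool" where
  "Ck_on 0 f T \<longleftrightarrow> continuous_on T f"
| "Ck_on (Suc k) f T \<longleftrightarrow> (\<forall>x\<in>T. f differentiable (at x)) \<and>
     (\<forall>v. Ck_on k (\<lambda>x. frechet_derivative f (at x) v) T)"

text \<open>On an arbitrary set, smooth means infinitely differentiable on an open neighbourhood, so that
  derivatives at points of the set are the ordinary ones.\<close>

definition smooth_on :: "'a::euclidean_space set \<Rightarrow> ('a \<Rightarrow> 'b::real_normed_vector) \<Rightarrow> bool" where
  "smooth_on S f \<longleftrightarrow> (\<exists>T. open T \<and> S \<subseteq> T \<and> (\<forall>k. Ck_on k f T))"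


section \<open>Control systems\<close>

text \<open>A signal is a pair of its domain, an open interval around 0 (possibly unbounded), and a
  function that is \<^term>\<open>undefined\<close> outside that domain.\<close>

definition input_signals :: "(real^'m) set \<Rightarrow> (real set \<times> (real \<Rightarrow> real^'m)) set" where
  "input_signals U = {(I, \<upsilon>).
     (\<exists>a b. a < 0 \<and> 0 < b \<and> I = einterval a b) \<and>
     \<upsilon> \<in> I \<rightarrow>\<^sub>E U \<and>
     \<upsilon> \<in> borel_measurable (lebesgue_on I) \<and>
     (\<forall>K. compact K \<and> K \<subseteq> I \<longrightarrow> (\<exists>M. AE t in lebesgue_on K. norm (\<upsilon> t) \<le> M))}"

text \<open>The state space is the type \<^typ>\<open>real^'n\<close>; the values of the dynamics at inputs outside the
  input set are irrelevant.\<close>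

record ('n, 'm) control_sys =
  input_set :: "(real^'m) set"
  inputs :: "(real set \<times> (real \<Rightarrow> real^'m)) set"
  dynamics :: "real^'n \<Rightarrow> real^'m \<Rightarrow> real^'n"

definition control_system :: "('n::finite, 'm::finite) control_sys \<Rightarrow> bool" where
  "control_system S \<longleftrightarrow>
     inputs S = input_signals (input_set S) \<and>
     continuous_on (UNIV \<times> input_set S) (\<lambda>(x, u). dynamics S x u) \<and>
     (\<forall>Q. compact Q \<longrightarrow> (\<exists>Z>0. \<forall>x\<in>Q. \<forall>y\<in>Q. \<forall>u\<in>input_set S.
        norm (dynamics S x u - dynamics S y u) \<le> Z * norm (x - y)))"

definition smooth_control_system :: "('n::finite, 'm::finite) control_sys \<Rightarrow> bool" where
  "smooth_control_system S \<longleftrightarrow>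
     control_system S \<and> smooth_on (UNIV \<times> input_set S) (\<lambda>(x, u). dynamics S x u)"

definition mk_control_sys ::
  "(real^'m) set \<Rightarrow> (real^'n \<Rightarrow> real^'m \<Rightarrow> real^'n) \<Rightarrow> ('n, 'm) control_sys" where
  "mk_control_sys U h = \<lparr>input_set = U, inputs = input_signals U, dynamics = h\<rparr>"

text \<open>The system that results from the feedback law u = k(x,v) with new input v in V.\<close>

definition closed_loop ::
  "('n, 'm) control_sys \<Rightarrow> (real^'l) set \<Rightarrow> (real^'n \<Rightarrow> real^'l \<Rightarrow> real^'m) \<Rightarrow> ('n, 'l) control_sys" where
  "closed_loop S V k = mk_control_sys V (\<lambda>x v. dynamics S x (k x v))"


section \<open>Contraction metrics\<close>

definition form :: "real^'n^'n \<Rightarrow> real^'n \<Rightarrow> real^'n \<Rightarrow> real" where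
  "form H I J = I \<bullet> (H *v J)"

definition riemannian_metric :: "(real^'n \<Rightarrow> real^'n^'n) \<Rightarrow> bool" where
  "riemannian_metric G \<longleftrightarrow> smooth_on UNIV G \<and>
     (\<forall>x. transpose (G x) = G x \<and> (\<forall>X. X \<noteq> 0 \<longrightarrow> form (G x) X X > 0))"

definition metric_derivative :: "(real^'n \<Rightarrow> real^'n^'n) \<Rightarrow> real^'n \<Rightarrow> real^'n \<Rightarrow> real^'n^'n" where
  "metric_derivative G x w =
     (\<chi> i j. \<Sum>k\<in>UNIV. frechet_derivative (\<lambda>x. G x $ i $ j) (at x) (axis k 1) * w $ k)"

definition contraction_matrix ::
  "(real^'n \<Rightarrow> real^'n^'n) \<Rightarrow> (real^'n \<Rightarrow> real^'m \<Rightarrow> real^'n) \<Rightarrow> real^'n \<Rightarrow> real^'m \<Rightarrow> real^'n^'n" where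
  "contraction_matrix G h x u =
     transpose (jacobian (\<lambda>x. h x u) (at x)) ** G x + G x ** jacobian (\<lambda>x. h x u) (at x)
       + metric_derivative G x (h x u)"

definition contraction_metric_with ::
  "('n::finite, 'm::finite) control_sys \<Rightarrow> (real^'n \<Rightarrow> real^'n^'n) \<Rightarrow> real \<Rightarrow> real \<Rightarrow> bool" where
  "contraction_metric_with S G lam \<alpha> \<longleftrightarrow>
     smooth_control_system S \<and> riemannian_metric G \<and> lam > 0 \<and> \<alpha> \<ge> 0 \<and>
     (\<forall>X x Y. \<forall>u\<in>input_set S.
        form (contraction_matrix G (dynamics S) x u) X X
          + 2 * form (G x) (jacobian (\<lambda>u. dynamics S x u) (at u) *v Y) X
        \<le> - lam * form (G x) X X + \<alpha> * sqrt (form (G x) X X) * sqrt (form (mat 1) Y Y))"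

definition contraction_metric ::
  "('n::finite, 'm::finite) control_sys \<Rightarrow> (real^'n \<Rightarrow> real^'n^'n) \<Rightarrow> bool" where
  "contraction_metric S G \<longleftrightarrow> (\<exists>lam \<alpha>. contraction_metric_with S G lam \<alpha>)"


section \<open>The cascade and its backstepping feedback\<close>

text \<open>A state x = (y, z) of the cascade is a vector indexed by the disjoint sum of the two index
  types.\<close>

definition vec_join :: "real^'p \<Rightarrow> real^'q \<Rightarrow> real^('p + 'q)" where
  "vec_join y z = (\<chi> i. case i of Inl a \<Rightarrow> y $ a | Inr b \<Rightarrow> z $ b)"

definition fst_part :: "real^('p::finite + 'q::finite) \<Rightarrow> real^'p" where
  "fst_part x = (\<chi> a. x $ Inl a)"

definition snd_part :: "real^('p::finite + 'q::finite) \<Rightarrow> real^'q" where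
  "snd_part x = (\<chi> b. x $ Inr b)"

definition block_matrix ::
  "real^'p^'p \<Rightarrow> real^'q^'p \<Rightarrow> real^'p^'q \<Rightarrow> real^'q^'q \<Rightarrow> real^('p + 'q)^('p + 'q)" where
  "block_matrix A B C D = (\<chi> i j. case i of
       Inl a \<Rightarrow> (case j of Inl a' \<Rightarrow> A $ a $ a' | Inr b' \<Rightarrow> B $ a $ b')
     | Inr b \<Rightarrow> (case j of Inl a' \<Rightarrow> C $ b $ a' | Inr b' \<Rightarrow> D $ b $ b'))"

definition cascade ::
  "(real^'p \<Rightarrow> real^'q \<Rightarrow> real^'p) \<Rightarrow> ('p + 'q, 'q) control_sys" where
  "cascade f = mk_control_sys UNIV (\<lambda>x \<upsilon>. vec_join (f (fst_part x) (snd_part x)) \<upsilon>)"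

definition eta_system ::
  "(real^'p \<Rightarrow> real^'q \<Rightarrow> real^'p) \<Rightarrow> (real^'p \<Rightarrow> real^'q) \<Rightarrow> ('p, 'q) control_sys" where
  "eta_system f \<psi> = mk_control_sys UNIV (\<lambda>y \<upsilon>. f y (\<psi> y + \<upsilon>))"

definition backstepping_law ::
  "(real^'p \<Rightarrow> real^'q \<Rightarrow> real^'p) \<Rightarrow> (real^'p \<Rightarrow> real^'q) \<Rightarrow> real \<Rightarrow>
     real^('p + 'q) \<Rightarrow> real^'q \<Rightarrow> real^'q" where
  "backstepping_law f \<psi> lam x \<upsilon> = (let y = fst_part x; z = snd_part x in
     - (lam *\<^sub>R (z - \<psi> y)) + jacobian \<psi> (at y) *v f y z + \<upsilon>)"

text \<open>The Jacobian of \<open>\<psi>\<close> is a block of this matrix, so for continuously differentiable \<open>\<psi>\<close> it is a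
  smooth function of the state only if \<open>\<psi>\<close> is smooth.\<close>

definition backstepping_metric ::
  "(real^'p \<Rightarrow> real^'p^'p) \<Rightarrow> (real^'p \<Rightarrow> real^'q) \<Rightarrow> real^('p + 'q) \<Rightarrow> real^('p + 'q)^('p + 'q)" where
  "backstepping_metric G \<psi> x = (let y = fst_part x; J = jacobian \<psi> (at y) in
     block_matrix (G y + transpose J ** J) (- transpose J) (- J) (mat 1))"

end

theory Submission
  imports Defs
begin

text \<open>
  In the coordinates \<open>(y, e)\<close> with \<open>e = z - \<psi> y\<close> the closed loop is again a cascade,
  \<open>y' = f y (\<psi> y + e)\<close> and \<open>e' = - lam e + \<upsilon>\<close>: the term \<open>(\<partial>\<psi>/\<partial>y) f\<close> of the feedback cancels
  exactly the drift of \<open>\<psi> y\<close>. The metric of the theorem is the block diagonal metric with blocks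
  \<open>G y\<close> and the identity, pulled back along this change of coordinates: with
  \<open>X = (Y, Z)\<close> and \<open>E = Z - (\<partial>\<psi>/\<partial>y) Y\<close>, its quadratic form is \<open>\<langle>Y, Y\<rangle>\<^sub>G + \<bar>E\<bar>\<^sup>2\<close>
  (\<open>form_backstepping_metric\<close>). The contraction form of the closed loop is therefore that of the
  driven subsystem, with \<open>E\<close> in the role of its input variation, minus \<open>2 lam \<bar>E\<bar>\<^sup>2\<close>
  (\<open>form_contraction_matrix_backstepping\<close>). The identity is proved in the original coordinates, where
  the second derivatives of \<open>\<psi>\<close> cancel because they are symmetric; the derivative along the flow
  moves the Jacobian of \<open>\<psi>\<close> inside the metric, while the variation of the feedback moves the same
  Jacobian in the direction \<open>Y\<close>.

  With \<open>a\<close> the \<open>G\<close>-length of \<open>Y\<close> and \<open>e = \<bar>E\<bar>\<close>, the hypothesis bounds the contraction form by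
  \<open>- lam_hat a\<^sup>2 + \<alpha> a e - 2 lam e\<^sup>2\<close>. This quadratic form is negative definite exactly when
  \<open>\<alpha>\<^sup>2 < 8 lam_hat lam\<close>, and then it is at most \<open>- \<mu> (a\<^sup>2 + e\<^sup>2)\<close> for some \<open>\<mu> > 0\<close>
  (\<open>cross_term_absorbed\<close>). A variation \<open>V\<close> of the new input contributes
  \<open>2 (V \<bullet> E) \<le> 2 \<bar>V\<bar> \<bar>E\<bar>\<close>, so the closed loop satisfies the inequality with the
  constants \<open>\<mu>\<close> and \<open>2\<close>.\<close>

section \<open>Calculus of smooth functions\<close>

lemma smooth_on_UNIV: "smooth_on UNIV f \<longleftrightarrow> (\<forall>k. Ck_on k f UNIV)"
  by (auto simp: smooth_on_def top.extremum_unique)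

lemma Ck_on_SucD: "Ck_on (Suc k) f UNIV \<Longrightarrow> Ck_on k f UNIV"
proof (induction k arbitrary: f)
  case 0
  then show ?case
    by (auto simp: continuous_on_eq_continuous_at intro: differentiable_imp_continuous_within)
next
  case (Suc k)
  have "\<forall>x. f differentiable (at x)"
    using Suc.prems unfolding Ck_on.simps(2)[of "Suc k"] by blast
  moreover have "Ck_on k (\<lambda>x. frechet_derivative f (at x) v) UNIV" for v
  proof (rule Suc.IH)
    show "Ck_on (Suc k) (\<lambda>x. frechet_derivative f (at x) v) UNIV"
      using Suc.prems unfolding Ck_on.simps(2)[of "Suc k"] by blast
  qed
  ultimately show ?case
    unfolding Ck_on.simps(2) by blast
qed

text \<open>Differentiating once and continuing by induction is the pattern of all closure properties below; this
  rule hides \<^const>\<open>frechet_derivative\<close> behind whatever expression a differentiation rule supplies.\<close>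

lemma Ck_on_SucI:
  assumes D: "\<And>x. (f has_derivative D x) (at x)" and C: "\<And>v. Ck_on k (\<lambda>x. D x v) UNIV"
  shows "Ck_on (Suc k) f UNIV"
proof -
  have *: "frechet_derivative f (at x) = D x" for x
    by (rule frechet_derivative_at[OF D, symmetric])
  have **: "f differentiable (at x)" for x
    using D by (rule differentiableI)
  show ?thesis
    unfolding Ck_on.simps(2) * using ** C by blast
qed

lemma Ck_on_SucE:
  assumes "Ck_on (Suc k) f UNIV"
  obtains "\<And>x. (f has_derivative frechet_derivative f (at x)) (at x)"
    "\<And>v. Ck_on k (\<lambda>x. frechet_derivative f (at x) v) UNIV" "Ck_on k f UNIV"
proof
  show "(f has_derivative frechet_derivative f (at x)) (at x)" for x
    using assms unfolding Ck_on.simps(2) frechet_derivative_works by blast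
  show "Ck_on k (\<lambda>x. frechet_derivative f (at x) v) UNIV" for v
    using assms unfolding Ck_on.simps(2) by blast
  show "Ck_on k f UNIV"
    by (rule Ck_on_SucD[OF assms])
qed

lemma Ck_on_const: "Ck_on k (\<lambda>x. c) UNIV"
  by (induction k arbitrary: c) auto

lemma Ck_on_bounded_linear:
  assumes L: "bounded_linear L" and "Ck_on k f UNIV"
  shows "Ck_on k (\<lambda>x. L (f x)) UNIV"
  using assms(2)
proof (induction k arbitrary: f)
  case 0
  then show ?case
    by (simp add: bounded_linear.continuous_on[OF L])
next
  case (Suc k)
  from Suc.prems show ?case
    by (elim Ck_on_SucE) (rule Ck_on_SucI[OF bounded_linear.has_derivative[OF L] Suc.IH])
qed

lemma Ck_on_compose_linear:
  assumes L: "bounded_linear L" and "Ck_on k f UNIV"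
  shows "Ck_on k (\<lambda>x. f (L x)) UNIV"
  using assms(2)
proof (induction k arbitrary: f)
  case 0
  then have "continuous_on (range L) f"
    using continuous_on_subset by auto
  then show ?case
    using linear_continuous_on[OF L] by (auto intro: continuous_on_compose2)
next
  case (Suc k)
  from Suc.prems show ?case
  proof (rule Ck_on_SucE)
    assume D: "\<And>x. (f has_derivative frechet_derivative f (at x)) (at x)"
      "\<And>v. Ck_on k (\<lambda>x. frechet_derivative f (at x) v) UNIV"
    show ?thesis
      by (rule Ck_on_SucI[OF has_derivative_compose[OF bounded_linear_imp_has_derivative[OF L] D(1)]
            Suc.IH[OF D(2)]])
  qed
qed

lemma Ck_on_add:
  assumes "Ck_on k f UNIV" "Ck_on k g UNIV"
  shows "Ck_on k (\<lambda>x. f x + g x) UNIV"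
  using assms
proof (induction k arbitrary: f g)
  case 0
  then show ?case by (simp add: continuous_on_add)
next
  case (Suc k)
  from Suc.prems show ?case
    by (elim Ck_on_SucE) (rule Ck_on_SucI[OF has_derivative_add Suc.IH])
qed

text \<open>By the product rule the derivative is a sum of two products, each with one factor differentiated. The
  other factor has lost no order of smoothness and is demoted from \<open>Suc k\<close> to \<open>k\<close>.\<close>

lemma Ck_on_bounded_bilinear:
  assumes B: "bounded_bilinear B" and "Ck_on k f UNIV" "Ck_on k g UNIV"
  shows "Ck_on k (\<lambda>x. B (f x) (g x)) UNIV"
  using assms(2,3)
proof (induction k arbitrary: f g)
  case 0
  then show ?case
    by (simp add: bounded_bilinear.continuous_on[OF B])
next
  case (Suc k)
  from Suc.prems show ?case
    by (elim Ck_on_SucE)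
      (rule Ck_on_SucI[OF bounded_bilinear.FDERIV[OF B] Ck_on_add[OF Suc.IH Suc.IH]])
qed

lemma smooth_const: "smooth_on UNIV (\<lambda>x. c)"
  unfolding smooth_on_UNIV by (intro allI Ck_on_const)

lemma smooth_bounded_linear:
  "bounded_linear L \<Longrightarrow> smooth_on UNIV f \<Longrightarrow> smooth_on UNIV (\<lambda>x. L (f x))"
  unfolding smooth_on_UNIV by (blast intro: Ck_on_bounded_linear)

lemma smooth_compose_linear:
  "bounded_linear L \<Longrightarrow> smooth_on UNIV f \<Longrightarrow> smooth_on UNIV (\<lambda>x. f (L x))"
  unfolding smooth_on_UNIV by (blast intro: Ck_on_compose_linear)

lemma smooth_add:
  "smooth_on UNIV f \<Longrightarrow> smooth_on UNIV g \<Longrightarrow> smooth_on UNIV (\<lambda>x. f x + g x)"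
  unfolding smooth_on_UNIV by (blast intro: Ck_on_add)

lemma smooth_bounded_bilinear:
  "bounded_bilinear B \<Longrightarrow> smooth_on UNIV f \<Longrightarrow> smooth_on UNIV g \<Longrightarrow> smooth_on UNIV (\<lambda>x. B (f x) (g x))"
  unfolding smooth_on_UNIV by (blast intro: Ck_on_bounded_bilinear)

lemma smooth_sum:
  "(\<And>i. i \<in> I \<Longrightarrow> smooth_on UNIV (f i)) \<Longrightarrow> smooth_on UNIV (\<lambda>x. \<Sum>i\<in>I. f i x)"
proof (induction I rule: infinite_finite_induct)
  case (insert i I)
  then have "smooth_on UNIV (\<lambda>x. f i x + (\<Sum>i\<in>I. f i x))"
    by (intro smooth_add) auto
  then show ?case
    using insert.hyps by simp
qed (simp_all add: smooth_const)

lemma smooth_linear: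
  assumes "bounded_linear L"
  shows "smooth_on UNIV L"
proof -
  have "Ck_on k L UNIV" for k
  proof (cases k)
    case 0
    then show ?thesis
      using assms by (simp add: linear_continuous_on)
  next
    case (Suc n)
    show ?thesis
      unfolding Suc by (rule Ck_on_SucI[OF bounded_linear_imp_has_derivative[OF assms] Ck_on_const])
  qed
  then show ?thesis
    by (simp add: smooth_on_UNIV)
qed

lemma smooth_frechet_derivative:
  "smooth_on UNIV f \<Longrightarrow> smooth_on UNIV (\<lambda>x. frechet_derivative f (at x) v)"
  unfolding smooth_on_UNIV by (blast elim: Ck_on_SucE)

lemma smooth_has_derivative:
  "smooth_on UNIV f \<Longrightarrow> (f has_derivative frechet_derivative f (at x)) (at x)"
  unfolding smooth_on_UNIV by (meson Ck_on_SucE)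

lemma smooth_continuous_on: "smooth_on UNIV f \<Longrightarrow> continuous_on S f"
  using has_derivative_at_withinI[OF smooth_has_derivative, THEN has_derivative_continuous]
  by (auto simp: continuous_on_eq_continuous_within)

text \<open>The mean value inequality needs a convex domain, so the derivative is bounded on the convex hull, which
  is still compact. Only the directional derivatives are known to be continuous; the sum of their bounds
  over a basis bounds the operator norm.\<close>

lemma smooth_Lipschitz_on_compact:
  fixes f :: "'a::euclidean_space \<Rightarrow> 'b::real_normed_vector"
  assumes f: "smooth_on UNIV f" and Q: "compact Q"
  shows "\<exists>Z>0. \<forall>x\<in>Q. \<forall>y\<in>Q. norm (f x - f y) \<le> Z * norm (x - y)"
proof -
  let ?K = "convex hull Q"
  have K: "compact ?K" "convex ?K" "Q \<subseteq> ?K"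
    using Q by (simp_all add: compact_convex_hull hull_subset)
  have "\<exists>M. \<forall>x\<in>?K. norm (frechet_derivative f (at x) b) \<le> M" for b
    using compact_imp_bounded[OF compact_continuous_image[OF
        smooth_continuous_on[OF smooth_frechet_derivative[OF f]] K(1)], of b]
    by (auto simp: bounded_iff)
  then obtain M where M: "\<And>b x. x \<in> ?K \<Longrightarrow> norm (frechet_derivative f (at x) b) \<le> M b"
    by metis
  define Z where "Z = (\<Sum>b\<in>Basis. \<bar>M b\<bar>) + 1"
  have "Z > 0"
    unfolding Z_def by (intro add_nonneg_pos sum_nonneg) simp_all
  have "onorm (frechet_derivative f (at x)) \<le> Z" if "x \<in> ?K" for x
  proof -
    have lin: "bounded_linear (frechet_derivative f (at x))"
      using smooth_has_derivative[OF f] by (rule has_derivative_bounded_linear)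
    have "onorm (frechet_derivative f (at x)) \<le> (\<Sum>b\<in>Basis. norm (frechet_derivative f (at x) b))"
      by (rule onorm_componentwise[OF lin])
    also have "\<dots> \<le> (\<Sum>b\<in>Basis. \<bar>M b\<bar>)"
      using M[OF that] by (intro sum_mono) (meson abs_ge_self order_trans)
    finally show ?thesis by (simp add: Z_def)
  qed
  then have "norm (f x - f y) \<le> Z * norm (x - y)" if "x \<in> Q" "y \<in> Q" for x y
    using that K(3)
    by (intro differentiable_bound[OF K(2), of f "\<lambda>x. frechet_derivative f (at x)"])
       (auto intro!: has_derivative_at_withinI smooth_has_derivative[OF f])
  with \<open>Z > 0\<close> show ?thesis by blast
qed


section \<open>Symmetry of second derivatives\<close>

lemma has_derivative_along_line:
  fixes f :: "'a::real_normed_vector \<Rightarrow> real"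
  assumes "(f has_derivative D) (at (p + t *\<^sub>R u))"
  shows "((\<lambda>t. f (p + t *\<^sub>R u)) has_derivative (\<lambda>r. r * D u)) (at t within S)"
proof -
  have "((\<lambda>t. f (p + t *\<^sub>R u)) has_derivative (\<lambda>r. D (r *\<^sub>R u))) (at t within S)"
    by (rule has_derivative_compose[where g = f and f = "\<lambda>t. p + t *\<^sub>R u", OF _ assms])
      (auto intro!: derivative_eq_intros)
  then show ?thesis
    by (simp add: linear_cmul[OF has_derivative_linear[OF assms]])
qed

text \<open>Two applications of the mean value theorem: first along \<open>u\<close> to the difference of \<open>f\<close> between
  the two sides of the parallelogram, then along \<open>v\<close> to the resulting directional derivative.\<close>

lemma second_difference_mean_value:
  fixes f :: "'a::real_normed_vector \<Rightarrow> real"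
  assumes f: "\<And>x. (f has_derivative D x) (at x)"
    and D: "\<And>x. ((\<lambda>x. D x u) has_derivative H x) (at x)"
    and "h > 0"
  obtains s t where "s \<in> {0..h}" "t \<in> {0..h}"
    "f (x + h *\<^sub>R u + h *\<^sub>R v) - f (x + h *\<^sub>R u) - f (x + h *\<^sub>R v) + f x
       = h\<^sup>2 * H (x + s *\<^sub>R u + t *\<^sub>R v) v"
proof -
  \<comment> \<open>difference between the two sides parallel to \<open>u\<close>, at parameter \<open>s\<close>\<close>
  define g where "g s = f (x + h *\<^sub>R v + s *\<^sub>R u) - f (x + s *\<^sub>R u)" for s
  have g: "(g has_derivative (\<lambda>r. r * D (x + h *\<^sub>R v + s *\<^sub>R u) u - r * D (x + s *\<^sub>R u) u))
      (at s within {0..h})" for s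
    unfolding g_def by (intro has_derivative_diff has_derivative_along_line f)
  obtain s where s: "s \<in> {0<..<h}"
    "g h - g 0 = (h - 0) * D (x + h *\<^sub>R v + s *\<^sub>R u) u - (h - 0) * D (x + s *\<^sub>R u) u"
    using mvt_simple[OF \<open>h > 0\<close> g] by blast
  define k where "k t = D (x + s *\<^sub>R u + t *\<^sub>R v) u" for t
  have k: "(k has_derivative (\<lambda>r. r * H (x + s *\<^sub>R u + t *\<^sub>R v) v)) (at t within {0..h})" for t
    unfolding k_def by (rule has_derivative_along_line[of "\<lambda>y. D y u", OF D])
  obtain t where t: "t \<in> {0<..<h}" "k h - k 0 = (h - 0) * H (x + s *\<^sub>R u + t *\<^sub>R v) v"
    using mvt_simple[OF \<open>h > 0\<close> k] by blast
  have eq: "x + h *\<^sub>R v + s *\<^sub>R u = x + s *\<^sub>R u + h *\<^sub>R v"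
    by (simp add: ac_simps)
  have "g h - g 0 = h * (k h - k 0)"
    using s(2) unfolding k_def eq by (simp add: right_diff_distrib)
  also have "\<dots> = h\<^sup>2 * H (x + s *\<^sub>R u + t *\<^sub>R v) v"
    using t(2) by (simp add: power2_eq_square)
  finally show ?thesis
    using that[of s t] s(1) t(1) by (simp add: g_def ac_simps)
qed

text \<open>The second difference over a parallelogram does not depend on the order of its two sides, so at every
  scale \<open>h\<close> the two mixed derivatives agree at suitable points of the parallelogram. If they differed
  at \<open>x\<close>, continuity would separate their values near \<open>x\<close>.\<close>

lemma second_derivative_symmetric_real:
  fixes f :: "'a::euclidean_space \<Rightarrow> real"
  assumes f: "smooth_on UNIV f"
  shows "frechet_derivative (\<lambda>x. frechet_derivative f (at x) u) (at x) v
       = frechet_derivative (\<lambda>x. frechet_derivative f (at x) v) (at x) u"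
    (is "?A x = ?B x")
proof (rule ccontr)
  assume "?A x \<noteq> ?B x"
  then have e: "\<bar>?A x - ?B x\<bar> / 2 > 0" (is "?e > 0") by simp
  have D: "smooth_on UNIV (\<lambda>x. frechet_derivative f (at x) w)" for w
    by (rule smooth_frechet_derivative[OF f])
  have "isCont ?A x" "isCont ?B x"
    using smooth_continuous_on[OF smooth_frechet_derivative[OF D], of UNIV]
    by (simp_all add: continuous_on_eq_continuous_at)
  then have "\<exists>a>0. \<forall>y. dist y x < a \<longrightarrow> dist (?A y) (?A x) < ?e"
    "\<exists>b>0. \<forall>y. dist y x < b \<longrightarrow> dist (?B y) (?B x) < ?e"
    using e unfolding continuous_at_eps_delta by blast+
  then obtain a b where a: "a > 0" "\<And>y. dist y x < a \<Longrightarrow> dist (?A y) (?A x) < ?e"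
    and b: "b > 0" "\<And>y. dist y x < b \<Longrightarrow> dist (?B y) (?B x) < ?e"
    by blast
  \<comment> \<open>the added \<open>1\<close> keeps the parallelogram strictly inside both balls and the denominator positive\<close>
  define h where "h = min a b / (norm u + norm v + 1)"
  have "norm u + norm v + 1 > 0"
    by (simp add: add_nonneg_pos)
  then have h: "h > 0" "h * (norm u + norm v + 1) = min a b"
    using a(1) b(1) by (simp_all add: h_def)
  have near: "dist (x + s *\<^sub>R w + t *\<^sub>R w') x < min a b"
    if "s \<in> {0..h}" "t \<in> {0..h}" "norm w + norm w' = norm u + norm v" for s t w w'
  proof -
    have "dist (x + s *\<^sub>R w + t *\<^sub>R w') x \<le> s * norm w + t * norm w'"
      using that norm_triangle_ineq[of "s *\<^sub>R w" "t *\<^sub>R w'"] by (simp add: dist_norm)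
    also have "\<dots> \<le> h * norm w + h * norm w'"
      using that by (intro add_mono mult_right_mono) auto
    also have "\<dots> < h * norm w + h * norm w' + h"
      using h(1) by simp
    also have "\<dots> = h * (norm w + norm w' + 1)"
      by (simp only: distrib_left mult_1_right)
    also have "\<dots> = min a b"
      using h(2) that(3) by simp
    finally show ?thesis .
  qed
  let ?\<Delta> = "f (x + h *\<^sub>R u + h *\<^sub>R v) - f (x + h *\<^sub>R u) - f (x + h *\<^sub>R v) + f x"
  obtain s t where st: "s \<in> {0..h}" "t \<in> {0..h}" "?\<Delta> = h\<^sup>2 * ?A (x + s *\<^sub>R u + t *\<^sub>R v)"
    by (rule second_difference_mean_value[where f = f and x = x and u = u and v = v
          and D = "\<lambda>x. frechet_derivative f (at x)"
          and H = "\<lambda>x. frechet_derivative (\<lambda>x. frechet_derivative f (at x) u) (at x)",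
          OF smooth_has_derivative[OF f] smooth_has_derivative[OF D] h(1)])
  obtain s' t' where st': "s' \<in> {0..h}" "t' \<in> {0..h}"
      "f (x + h *\<^sub>R v + h *\<^sub>R u) - f (x + h *\<^sub>R v) - f (x + h *\<^sub>R u) + f x
        = h\<^sup>2 * ?B (x + s' *\<^sub>R v + t' *\<^sub>R u)"
    by (rule second_difference_mean_value[where f = f and x = x and u = v and v = u
          and D = "\<lambda>x. frechet_derivative f (at x)"
          and H = "\<lambda>x. frechet_derivative (\<lambda>x. frechet_derivative f (at x) v) (at x)",
          OF smooth_has_derivative[OF f] smooth_has_derivative[OF D] h(1)])
  have "?\<Delta> = f (x + h *\<^sub>R v + h *\<^sub>R u) - f (x + h *\<^sub>R v) - f (x + h *\<^sub>R u) + f x"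
    by (simp add: ac_simps)
  then have "h\<^sup>2 * ?A (x + s *\<^sub>R u + t *\<^sub>R v) = h\<^sup>2 * ?B (x + s' *\<^sub>R v + t' *\<^sub>R u)"
    unfolding st(3) st'(3) .
  then have eq: "?A (x + s *\<^sub>R u + t *\<^sub>R v) = ?B (x + s' *\<^sub>R v + t' *\<^sub>R u)"
    using h(1) by simp
  have "dist (?A x) (?B x)
      \<le> dist (?A (x + s *\<^sub>R u + t *\<^sub>R v)) (?A x) + dist (?B (x + s' *\<^sub>R v + t' *\<^sub>R u)) (?B x)"
    using dist_triangle3[of "?A x" "?B x" "?A (x + s *\<^sub>R u + t *\<^sub>R v)"] by (simp only: eq)
  also have "\<dots> < ?e + ?e"
    using near[OF st(1,2), of u v] near[OF st'(1,2), of v u] by (intro add_strict_mono a(2) b(2)) auto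
  finally show False
    by (simp add: dist_real_def)
qed

lemma second_derivative_symmetric:
  fixes f :: "'a::euclidean_space \<Rightarrow> 'b::real_inner"
  assumes f: "smooth_on UNIV f"
  shows "frechet_derivative (\<lambda>x. frechet_derivative f (at x) u) (at x) v
       = frechet_derivative (\<lambda>x. frechet_derivative f (at x) v) (at x) u"
proof -
  have comp: "frechet_derivative (\<lambda>x. g x \<bullet> c) (at x) w = frechet_derivative g (at x) w \<bullet> c"
    if "smooth_on UNIV g" for g :: "'a \<Rightarrow> 'b" and c x w
    by (subst frechet_derivative_at[symmetric,
          OF has_derivative_inner_left[OF smooth_has_derivative[OF that]]]) simp
  have "frechet_derivative (\<lambda>x. frechet_derivative f (at x) u) (at x) v \<bullet> c
      = frechet_derivative (\<lambda>x. frechet_derivative f (at x) v) (at x) u \<bullet> c" for c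
    using second_derivative_symmetric_real[OF smooth_bounded_linear[OF bounded_linear_inner_left f], of c u x v]
    by (simp add: comp f smooth_frechet_derivative)
  then show ?thesis
    using vector_eq_rdot by blast
qed


section \<open>Block vectors and block matrices\<close>

lemma sum_UNIV_Plus:
  "(\<Sum>i\<in>UNIV. g i) = (\<Sum>a\<in>UNIV. g (Inl a)) + (\<Sum>b\<in>UNIV. g (Inr b))"
  for g :: "'p::finite + 'q::finite \<Rightarrow> 'c::comm_monoid_add"
  using sum.Plus[of "UNIV :: 'p set" "UNIV :: 'q set" g] by simp

lemma parts_vec_join [simp]:
  "fst_part (vec_join y z) = y" "snd_part (vec_join y z) = z"
  by (simp_all add: fst_part_def snd_part_def vec_join_def vec_eq_iff)

lemma bounded_linear_fst_part: "bounded_linear fst_part"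
  unfolding linear_conv_bounded_linear[symmetric] by (rule linearI) (simp_all add: fst_part_def vec_eq_iff)

lemma bounded_linear_snd_part: "bounded_linear snd_part"
  unfolding linear_conv_bounded_linear[symmetric] by (rule linearI) (simp_all add: snd_part_def vec_eq_iff)

lemma vec_join_add: "vec_join a b + vec_join c d = vec_join (a + c) (b + d)"
  by (simp add: vec_join_def vec_eq_iff split: sum.split)

lemma bounded_linear_vec_join_left: "bounded_linear (\<lambda>y. vec_join y 0)"
  unfolding linear_conv_bounded_linear[symmetric]
  by (rule linearI) (simp_all add: vec_join_def vec_eq_iff split: sum.split)

lemma bounded_linear_vec_join_right: "bounded_linear (vec_join 0)"
  unfolding linear_conv_bounded_linear[symmetric]
  by (rule linearI) (simp_all add: vec_join_def vec_eq_iff split: sum.split)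

lemma inner_parts: "X \<bullet> Y = fst_part X \<bullet> fst_part Y + snd_part X \<bullet> snd_part Y"
  by (simp add: inner_vec_def fst_part_def snd_part_def sum_UNIV_Plus)

lemma parts_block_matrix_mult:
  "fst_part (block_matrix A B C D *v X) = A *v fst_part X + B *v snd_part X"
  "snd_part (block_matrix A B C D *v X) = C *v fst_part X + D *v snd_part X"
  by (simp_all add: matrix_vector_mult_def fst_part_def snd_part_def block_matrix_def
      vec_eq_iff sum_UNIV_Plus)

lemma transpose_block_matrix:
  "transpose (block_matrix A B C D)
    = block_matrix (transpose A) (transpose C) (transpose B) (transpose D)"
  by (simp add: transpose_def block_matrix_def vec_eq_iff split: sum.split)

text \<open>A block matrix depends linearly on the quadruple of its blocks, hence is a sum of four linear images.\<close>

lemma smooth_block_matrix: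
  assumes "smooth_on UNIV A" "smooth_on UNIV B" "smooth_on UNIV C" "smooth_on UNIV D"
  shows "smooth_on UNIV (\<lambda>x. block_matrix (A x) (B x) (C x) (D x))"
proof -
  have *: "(\<lambda>x. block_matrix (A x) (B x) (C x) (D x))
      = (\<lambda>x. block_matrix (A x) 0 0 0 + (block_matrix 0 (B x) 0 0
            + (block_matrix 0 0 (C x) 0 + block_matrix 0 0 0 (D x))))"
    by (simp add: fun_eq_iff vec_eq_iff block_matrix_def split: sum.split)
  have lin: "bounded_linear (\<lambda>A. block_matrix A 0 0 0)" "bounded_linear (\<lambda>B. block_matrix 0 B 0 0)"
    "bounded_linear (\<lambda>C. block_matrix 0 0 C 0)" "bounded_linear (\<lambda>D. block_matrix 0 0 0 D)"
    unfolding linear_conv_bounded_linear[symmetric]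
    by (rule linearI; simp add: block_matrix_def vec_eq_iff split: sum.split)+
  show ?thesis
    unfolding *
    by (intro smooth_add smooth_bounded_linear[OF lin(1)] smooth_bounded_linear[OF lin(2)]
        smooth_bounded_linear[OF lin(3)] smooth_bounded_linear[OF lin(4)] assms)
qed

text \<open>The matrix is \<open>P\<close>, placed in the first diagonal block, plus \<open>T\<^sup>t T\<close> for the row of blocks
  \<open>T = [- N, 1]\<close>.\<close>

lemma form_block_matrix:
  "form (block_matrix (P + transpose N ** N) (- transpose N) (- N) (mat 1)) I J
    = form P (fst_part I) (fst_part J)
      + (snd_part I - N *v fst_part I) \<bullet> (snd_part J - N *v fst_part J)"
proof -
  have t: "v \<bullet> (transpose N *v w) = (N *v v) \<bullet> w" for v w
    by (metis dot_lmul_matrix inner_commute transpose_matrix_vector)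
  have m: "(- M) *v w = - (M *v w)" for M :: "real^'c::finite^'d::finite" and w
    using matrix_vector_mult_diff_rdistrib[of 0 M w] by simp
  show ?thesis
    by (simp add: form_def inner_parts parts_block_matrix_mult matrix_vector_mult_add_rdistrib
        matrix_vector_mul_assoc[symmetric] inner_add_right inner_diff_right inner_diff_left t m
        inner_commute del: transpose_matrix_vector)
qed


section \<open>Matrices of derivatives\<close>

lemma bounded_bilinear_matrix_vector_mult:
  "bounded_bilinear ((*v) :: real^'n^'m \<Rightarrow> real^'n \<Rightarrow> real^'m)"
  unfolding bilinear_conv_bounded_bilinear[symmetric] bilinear_def
  by (auto intro!: linearI simp: matrix_vector_mult_add_rdistrib scaleR_matrix_vector_assoc)

lemma bounded_bilinear_matrix_matrix_mult:
  "bounded_bilinear ((**) :: real^'n^'m \<Rightarrow> real^'k^'n \<Rightarrow> real^'k^'m)"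
  unfolding bilinear_conv_bounded_bilinear[symmetric] bilinear_def
  by (auto intro!: linearI
      simp: matrix_matrix_mult_def vec_eq_iff distrib_left distrib_right sum.distrib
        sum_distrib_left mult.assoc mult.left_commute)

lemma bounded_linear_transpose: "bounded_linear (transpose :: real^'n^'m \<Rightarrow> real^'m^'n)"
  unfolding linear_conv_bounded_linear[symmetric]
  by (rule linearI) (simp_all add: transpose_def vec_eq_iff)

lemma bounded_linear_form: "bounded_linear (\<lambda>H. form H I J)"
  unfolding form_def
  by (intro bounded_linear_inner_right_comp
      bounded_bilinear.bounded_linear_left[OF bounded_bilinear_matrix_vector_mult])

lemma jacobian_mult:
  fixes f :: "real^'m \<Rightarrow> real^'n"
  assumes "(f has_derivative D) (at x)"
  shows "jacobian f (at x) *v v = D v"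
proof -
  have "(f has_derivative (\<lambda>v. jacobian f (at x) *v v)) (at x)"
    using jacobian_works differentiableI[OF assms] by blast
  then show ?thesis
    using has_derivative_unique[OF assms] by simp
qed

text \<open>The Jacobian is assembled linearly from its columns, the derivatives along the coordinate axes.\<close>

lemma smooth_jacobian:
  fixes f :: "real^'m \<Rightarrow> real^'n"
  assumes "smooth_on UNIV f"
  shows "smooth_on UNIV (\<lambda>x. jacobian f (at x))"
proof -
  \<comment> \<open>the matrix with column \<open>j\<close> equal to \<open>w\<close> and all other columns zero\<close>
  let ?M = "\<lambda>j w. (\<chi> i k. if k = j then w $ i else 0) :: real^'m^'n"
  have "jacobian f (at x) = (\<Sum>j\<in>UNIV. ?M j (frechet_derivative f (at x) (axis j 1)))" for x
    by (simp add: jacobian_def matrix_def vec_eq_iff if_distrib cong: if_cong)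
  moreover have "bounded_linear (?M j)" for j
    unfolding linear_conv_bounded_linear[symmetric]
    by (rule linearI) (simp_all add: vec_eq_iff)
  ultimately show ?thesis
    by (simp add: smooth_sum smooth_bounded_linear[of "?M j" for j] smooth_frechet_derivative[OF assms])
qed

text \<open>Both sides are the second derivative of \<open>f\<close> in the directions \<open>v\<close> and \<open>w\<close>. This is the
  cancellation that makes the backstepping feedback work at the level of variations.\<close>

lemma jacobian_derivative_symmetric:
  fixes f :: "real^'m \<Rightarrow> real^'n"
  assumes "smooth_on UNIV f"
  shows "frechet_derivative (\<lambda>x. jacobian f (at x)) (at x) v *v w
       = frechet_derivative (\<lambda>x. jacobian f (at x)) (at x) w *v v"
proof -
  have *: "frechet_derivative (\<lambda>x. jacobian f (at x)) (at x) a *v b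
      = frechet_derivative (\<lambda>x. frechet_derivative f (at x) b) (at x) a" for a b
  proof -
    have "((\<lambda>x. jacobian f (at x) *v b) has_derivative
        (\<lambda>a. frechet_derivative (\<lambda>x. jacobian f (at x)) (at x) a *v b)) (at x)"
      by (rule bounded_linear.has_derivative[OF bounded_bilinear.bounded_linear_left[OF
              bounded_bilinear_matrix_vector_mult] smooth_has_derivative[OF smooth_jacobian[OF assms]]])
    then show ?thesis
      unfolding jacobian_mult[OF smooth_has_derivative[OF assms]]
      by (simp add: frechet_derivative_at[symmetric])
  qed
  show ?thesis
    unfolding * by (rule second_derivative_symmetric[OF assms])
qed

lemma metric_derivative_eq:
  assumes "(G has_derivative D) (at x)"
  shows "metric_derivative G x w = D w"
proof -
  have comp: "((\<lambda>x. G x $ i $ j) has_derivative (\<lambda>v. D v $ i $ j)) (at x)" for i j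
    by (intro bounded_linear.has_derivative[OF bounded_linear_vec_nth] assms)
  have "(\<Sum>k\<in>UNIV. D (axis k 1) $ i $ j * w $ k) = D w $ i $ j" for i j
  proof -
    have "D w = D (\<Sum>k\<in>UNIV. w $ k *\<^sub>R axis k 1)"
      using basis_expansion[of w] by (simp add: scalar_mult_eq_scaleR)
    also have "\<dots> = (\<Sum>k\<in>UNIV. w $ k *\<^sub>R D (axis k 1))"
      using has_derivative_linear[OF assms] by (simp add: linear_sum linear_cmul)
    finally show ?thesis
      by (simp add: mult.commute)
  qed
  then show ?thesis
    by (simp add: metric_derivative_def vec_eq_iff frechet_derivative_at[OF comp, symmetric])
qed

lemma form_commute:
  assumes "transpose H = H"
  shows "form H I J = form H J I"
  unfolding form_def by (metis assms dot_lmul_matrix inner_commute transpose_matrix_vector)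

text \<open>The contraction form is the derivative of the squared length \<open>\<langle>X, X\<rangle>\<^sub>G\<close> along the flow and the
  linearised flow: symmetry of \<open>G x\<close> makes the two Jacobian terms equal.\<close>

lemma form_contraction_matrix:
  assumes h: "((\<lambda>x. h x u) has_derivative A) (at x)" and G: "(G has_derivative D) (at x)"
    and sym: "transpose (G x) = G x"
  shows "form (contraction_matrix G h x u) X X = 2 * form (G x) (A X) X + form (D (h x u)) X X"
proof -
  let ?J = "jacobian (\<lambda>x. h x u) (at x)"
  have "X \<bullet> (transpose ?J *v (G x *v X)) = form (G x) (?J *v X) X"
    unfolding form_def by (metis dot_lmul_matrix inner_commute transpose_matrix_vector)
  moreover have "X \<bullet> (G x *v (?J *v X)) = form (G x) (?J *v X) X"
    using form_commute[OF sym] unfolding form_def .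
  ultimately have "form (contraction_matrix G h x u) X X
      = 2 * form (G x) (?J *v X) X + form (metric_derivative G x (h x u)) X X"
    unfolding contraction_matrix_def form_def
    by (simp add: matrix_vector_mult_add_rdistrib inner_add_right
        matrix_vector_mul_assoc[symmetric] del: transpose_matrix_vector)
  then show ?thesis
    by (simp add: jacobian_mult[OF h] metric_derivative_eq[OF G])
qed


section \<open>The closed loop and its metric\<close>

definition backstepping_dynamics ::
  "(real^'p \<Rightarrow> real^'q \<Rightarrow> real^'p) \<Rightarrow> (real^'p \<Rightarrow> real^'q) \<Rightarrow> real \<Rightarrow>
     real^('p + 'q) \<Rightarrow> real^'q \<Rightarrow> real^('p + 'q)" where
  "backstepping_dynamics f \<psi> lam x \<upsilon> = (let y = fst_part x; z = snd_part x in
     vec_join (f y z) (- (lam *\<^sub>R (z - \<psi> y)) + jacobian \<psi> (at y) *v f y z + \<upsilon>))"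

lemma closed_loop_backstepping:
  "closed_loop (cascade f) UNIV (backstepping_law f \<psi> lam)
    = mk_control_sys UNIV (backstepping_dynamics f \<psi> lam)"
  by (simp add: closed_loop_def cascade_def mk_control_sys_def backstepping_law_def
      backstepping_dynamics_def Let_def fun_eq_iff)

text \<open>Since the input only adds a constant, a Lipschitz constant for zero input serves all inputs at once,
  although the input set is unbounded.\<close>

lemma backstepping_dynamics_add_input:
  "backstepping_dynamics f \<psi> lam x \<upsilon> = backstepping_dynamics f \<psi> lam x 0 + vec_join 0 \<upsilon>"
  by (simp add: backstepping_dynamics_def Let_def vec_join_add)

context
  fixes f :: "real^'p \<Rightarrow> real^'q \<Rightarrow> real^'p" and \<psi> :: "real^'p \<Rightarrow> real^'q"
  assumes f: "smooth_on UNIV (\<lambda>(y, z). f y z)" and \<psi>: "smooth_on UNIV \<psi>"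
begin

lemma smooth_backstepping_dynamics_0: "smooth_on UNIV (\<lambda>x. backstepping_dynamics f \<psi> lam x 0)"
proof -
  have "smooth_on UNIV (\<lambda>x. (\<lambda>(y, z). f y z) (fst_part x, snd_part x))"
    by (rule smooth_compose_linear[OF bounded_linear_Pair[OF bounded_linear_fst_part bounded_linear_snd_part] f])
  then have F: "smooth_on UNIV (\<lambda>x. f (fst_part x) (snd_part x))"
    by simp
  have J: "smooth_on UNIV (\<lambda>x. jacobian \<psi> (at (fst_part x)))"
    by (rule smooth_compose_linear[OF bounded_linear_fst_part smooth_jacobian[OF \<psi>]])
  have \<psi>': "smooth_on UNIV (\<lambda>x. \<psi> (fst_part x))"
    by (rule smooth_compose_linear[OF bounded_linear_fst_part \<psi>])
  have "backstepping_dynamics f \<psi> lam x 0 = vec_join (f (fst_part x) (snd_part x)) 0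
    + vec_join 0 (((- lam) *\<^sub>R snd_part x + lam *\<^sub>R \<psi> (fst_part x))
        + jacobian \<psi> (at (fst_part x)) *v f (fst_part x) (snd_part x))" for x
    by (simp add: backstepping_dynamics_def Let_def vec_join_add algebra_simps)
  moreover have "smooth_on UNIV (\<lambda>x. vec_join (f (fst_part x) (snd_part x)) 0
    + vec_join 0 (((- lam) *\<^sub>R snd_part x + lam *\<^sub>R \<psi> (fst_part x))
        + jacobian \<psi> (at (fst_part x)) *v f (fst_part x) (snd_part x)))"
    by (intro smooth_add smooth_bounded_linear[OF bounded_linear_vec_join_left]
        smooth_bounded_linear[OF bounded_linear_vec_join_right]
        smooth_bounded_linear[OF bounded_linear_scaleR_right]
        smooth_bounded_bilinear[OF bounded_bilinear_matrix_vector_mult]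
        smooth_linear[OF bounded_linear_snd_part] F J \<psi>')
  ultimately show ?thesis
    by presburger
qed

lemma smooth_backstepping_dynamics:
  "smooth_on UNIV (\<lambda>(x, \<upsilon>). backstepping_dynamics f \<psi> lam x \<upsilon>)"
proof -
  have "(\<lambda>(x, \<upsilon>). backstepping_dynamics f \<psi> lam x \<upsilon>)
      = (\<lambda>p. backstepping_dynamics f \<psi> lam (fst p) 0 + vec_join 0 (snd p))"
    by (auto simp: fun_eq_iff intro: backstepping_dynamics_add_input)
  then show ?thesis
    using smooth_add[OF smooth_compose_linear[OF bounded_linear_fst smooth_backstepping_dynamics_0]
        smooth_bounded_linear[OF bounded_linear_vec_join_right smooth_linear[OF bounded_linear_snd]]]
    by simp
qed

lemma smooth_control_system_backstepping:
  "smooth_control_system (mk_control_sys UNIV (backstepping_dynamics f \<psi> lam))"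
proof -
  have "\<exists>Z>0. \<forall>x\<in>Q. \<forall>y\<in>Q. \<forall>u. norm (backstepping_dynamics f \<psi> lam x u - backstepping_dynamics f \<psi> lam y u)
      \<le> Z * norm (x - y)" if Q: "compact Q" for Q
  proof -
    obtain Z where "Z > 0" and Z: "\<forall>x\<in>Q. \<forall>y\<in>Q.
        norm (backstepping_dynamics f \<psi> lam x 0 - backstepping_dynamics f \<psi> lam y 0) \<le> Z * norm (x - y)"
      using smooth_Lipschitz_on_compact[OF smooth_backstepping_dynamics_0[of lam] Q] by blast
    have "norm (backstepping_dynamics f \<psi> lam x u - backstepping_dynamics f \<psi> lam y u)
        \<le> Z * norm (x - y)" if "x \<in> Q" "y \<in> Q" for x y u
    proof -
      have "backstepping_dynamics f \<psi> lam x u - backstepping_dynamics f \<psi> lam y u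
          = backstepping_dynamics f \<psi> lam x 0 - backstepping_dynamics f \<psi> lam y 0"
        by (subst (1 2) backstepping_dynamics_add_input) simp
      with Z that show ?thesis by metis
    qed
    with \<open>Z > 0\<close> show ?thesis by blast
  qed
  then show ?thesis
    using smooth_backstepping_dynamics[of lam] smooth_continuous_on[OF smooth_backstepping_dynamics[of lam]]
    by (simp add: smooth_control_system_def control_system_def mk_control_sys_def)
qed

end

text \<open>The pullback of the block diagonal metric under \<open>(y, z) \<mapsto> (y, z - \<psi> y)\<close>.\<close>

lemma form_backstepping_metric:
  fixes \<psi> :: "real^'p \<Rightarrow> real^'q"
  shows "form (backstepping_metric G \<psi> x) I J = form (G (fst_part x)) (fst_part I) (fst_part J)
    + (snd_part I - jacobian \<psi> (at (fst_part x)) *v fst_part I)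
      \<bullet> (snd_part J - jacobian \<psi> (at (fst_part x)) *v fst_part J)"
  by (simp add: backstepping_metric_def Let_def form_block_matrix)

lemma smooth_backstepping_metric:
  fixes G :: "real^'p \<Rightarrow> real^'p^'p" and \<psi> :: "real^'p \<Rightarrow> real^'q"
  assumes G: "smooth_on UNIV G" and \<psi>: "smooth_on UNIV \<psi>"
  shows "smooth_on UNIV (backstepping_metric G \<psi>)"
proof -
  let ?J = "\<lambda>y. jacobian \<psi> (at y)"
  have J: "smooth_on UNIV ?J"
    by (rule smooth_jacobian[OF \<psi>])
  have Jt: "smooth_on UNIV (\<lambda>y. transpose (?J y))"
    by (rule smooth_bounded_linear[OF bounded_linear_transpose J])
  have neg: "bounded_linear (uminus :: real^'c^'d \<Rightarrow> _)"
    by (rule bounded_linear_minus[OF bounded_linear_ident])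
  have "smooth_on UNIV (\<lambda>y. block_matrix (G y + transpose (?J y) ** ?J y) (- transpose (?J y)) (- ?J y) (mat 1))"
    by (intro smooth_block_matrix smooth_add G smooth_const
        smooth_bounded_bilinear[OF bounded_bilinear_matrix_matrix_mult Jt J]
        smooth_bounded_linear[OF neg Jt] smooth_bounded_linear[OF neg J])
  then show ?thesis
    unfolding backstepping_metric_def Let_def by (rule smooth_compose_linear[OF bounded_linear_fst_part])
qed

lemma riemannian_backstepping_metric:
  fixes G :: "real^'p \<Rightarrow> real^'p^'p" and \<psi> :: "real^'p \<Rightarrow> real^'q"
  assumes G: "riemannian_metric G" and \<psi>: "smooth_on UNIV \<psi>"
  shows "riemannian_metric (backstepping_metric G \<psi>)"
  unfolding riemannian_metric_def
proof (intro conjI allI impI)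
  show "smooth_on UNIV (backstepping_metric G \<psi>)"
    using G \<psi> by (simp add: riemannian_metric_def smooth_backstepping_metric)
  fix x :: "real^('p + 'q)"
  have sym: "transpose (G y) = G y" and pos: "Y \<noteq> 0 \<Longrightarrow> form (G y) Y Y > 0" for y Y
    using G by (simp_all add: riemannian_metric_def)
  have tr: "transpose (A + B) = transpose A + transpose B" "transpose (- C) = - transpose C"
    for A B :: "real^'p^'p" and C :: "real^'c^'d"
    by (simp_all add: transpose_def vec_eq_iff)
  show "transpose (backstepping_metric G \<psi> x) = backstepping_metric G \<psi> x"
    by (simp add: backstepping_metric_def Let_def transpose_block_matrix tr sym matrix_transpose_mul)
  fix X :: "real^('p + 'q)"
  assume "X \<noteq> 0"
  let ?Y = "fst_part X" and ?E = "snd_part X - jacobian \<psi> (at (fst_part x)) *v fst_part X"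
  have "form (G (fst_part x)) ?Y ?Y + ?E \<bullet> ?E > 0"
  proof (cases "?Y = 0")
    case True
    have "snd_part X \<noteq> 0"
    proof
      assume "snd_part X = 0"
      then have "X \<bullet> X = 0"
        using True by (simp add: inner_parts)
      with \<open>X \<noteq> 0\<close> show False by simp
    qed
    with True show ?thesis
      by (simp add: form_def)
  next
    case False
    then show ?thesis
      using pos by (simp add: add_pos_nonneg)
  qed
  then show "form (backstepping_metric G \<psi> x) X X > 0"
    by (simp add: form_backstepping_metric)
qed

lemma jacobian_backstepping_input:
  "jacobian (\<lambda>\<upsilon>. backstepping_dynamics f \<psi> lam x \<upsilon>) (at \<upsilon>) *v Y = vec_join 0 Y"
proof (rule jacobian_mult)
  have "((\<lambda>\<upsilon>. backstepping_dynamics f \<psi> lam x 0 + vec_join 0 \<upsilon>) has_derivative (\<lambda>Y. 0 + vec_join 0 Y)) (at \<upsilon>)"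
    by (intro has_derivative_add has_derivative_const
        bounded_linear_imp_has_derivative[OF bounded_linear_vec_join_right])
  then show "((\<lambda>\<upsilon>. backstepping_dynamics f \<psi> lam x \<upsilon>) has_derivative vec_join 0) (at \<upsilon>)"
    by (subst backstepping_dynamics_add_input) simp
qed

text \<open>Splitting of the contraction form of the closed loop in the coordinates \<open>(y, z - \<psi> y)\<close>.
  Two identities carry it. The variation \<open>Z\<close> of \<open>z\<close> is \<open>(\<partial>\<psi>/\<partial>y) Y + E\<close>, so that the
  linearisation of \<open>f\<close> along \<open>(Y, Z)\<close> is the linearised driven subsystem along \<open>Y\<close> plus its
  response to the input \<open>E\<close>. In the component of \<open>E\<close>, the Jacobian of \<open>\<psi>\<close> applied to this
  linearisation drops out, and
  of the second derivatives of \<open>\<psi>\<close> only a difference of two equal terms remains.\<close>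

lemma form_contraction_matrix_backstepping:
  fixes f :: "real^'p \<Rightarrow> real^'q \<Rightarrow> real^'p" and \<psi> :: "real^'p \<Rightarrow> real^'q"
  assumes f: "smooth_on UNIV (\<lambda>(y, z). f y z)" and \<psi>: "smooth_on UNIV \<psi>"
    and G: "riemannian_metric G"
  defines "h \<equiv> \<lambda>y u. f y (\<psi> y + u)"
  fixes x X :: "real^('p + 'q)"
  defines "y \<equiv> fst_part x" and "u \<equiv> snd_part x - \<psi> (fst_part x)"
    and "Y \<equiv> fst_part X" and "E \<equiv> snd_part X - jacobian \<psi> (at (fst_part x)) *v fst_part X"
  shows "form (contraction_matrix (backstepping_metric G \<psi>) (backstepping_dynamics f \<psi> lam) x \<upsilon>) X X
    = form (contraction_matrix G h y u) Y Y + 2 * form (G y) (jacobian (h y) (at u) *v E) Y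
      - 2 * lam * (E \<bullet> E)"
proof -
  define z where "z = snd_part x"
  define Z where "Z = snd_part X"
  define F where "F = frechet_derivative (\<lambda>(y, z). f y z) (at (y, z))"
  define J where "J = jacobian \<psi> (at y)"
  define J' where "J' = frechet_derivative (\<lambda>y. jacobian \<psi> (at y)) (at y)"
  define G' where "G' = frechet_derivative G (at y)"
  have F: "((\<lambda>(y, z). f y z) has_derivative F) (at (y, z))"
    unfolding F_def by (rule smooth_has_derivative[OF f])
  have D\<psi>: "(\<psi> has_derivative (*v) J) (at y)"
    using jacobian_works differentiableI[OF smooth_has_derivative[OF \<psi>]] unfolding J_def by blast
  have DJ: "((\<lambda>y. jacobian \<psi> (at y)) has_derivative J') (at y)"
    unfolding J'_def by (rule smooth_has_derivative[OF smooth_jacobian[OF \<psi>]])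
  have G': "(G has_derivative G') (at y)"
    using G unfolding G'_def riemannian_metric_def by (blast intro: smooth_has_derivative)
  have sym: "transpose (G y) = G y" "transpose (backstepping_metric G \<psi> x) = backstepping_metric G \<psi> x"
    using G riemannian_backstepping_metric[OF G \<psi>] by (simp_all add: riemannian_metric_def)
  have dfst: "(fst_part has_derivative fst_part) (at x)" and dsnd: "(snd_part has_derivative snd_part) (at x)"
    by (rule bounded_linear_imp_has_derivative bounded_linear_fst_part bounded_linear_snd_part)+
  have yu: "\<psi> y + u = z"
    by (simp add: u_def y_def z_def)
  have hyu: "h y u = f y z"
    by (simp add: h_def yu)
  note D_matvec = bounded_bilinear.FDERIV[OF bounded_bilinear_matrix_vector_mult]

  have "((\<lambda>y. (y, \<psi> y + u)) has_derivative (\<lambda>v. (v, J *v v))) (at y)"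
    using D\<psi> by (auto intro!: derivative_eq_intros)
  from has_derivative_compose[OF this, of "\<lambda>(y, z). f y z"] F
  have hy: "((\<lambda>y. h y u) has_derivative (\<lambda>v. F (v, J *v v))) (at y)"
    by (simp add: h_def yu)
  have "((\<lambda>u. (y, \<psi> y + u)) has_derivative (\<lambda>v. (0, v))) (at u)"
    by (auto intro!: derivative_eq_intros)
  from has_derivative_compose[OF this, of "\<lambda>(y, z). f y z"] F
  have hu: "(h y has_derivative (\<lambda>v. F (0, v))) (at u)"
    by (simp add: h_def[abs_def] yu)
  \<comment> \<open>the variation of \<open>z\<close> splits into what follows \<open>\<psi>\<close> and the deviation \<open>E\<close>\<close>
  have "(Y, J *v Y) + (0, E) = (Y, Z)"
    by (simp add: E_def Z_def Y_def J_def y_def)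
  then have Fsum: "F (Y, J *v Y) + F (0, E) = F (Y, Z)"
    by (metis F has_derivative_linear linear_add)

  have df: "((\<lambda>x. f (fst_part x) (snd_part x)) has_derivative (\<lambda>V. F (fst_part V, snd_part V))) (at x)"
    using has_derivative_compose[OF has_derivative_Pair[OF dfst dsnd], of "\<lambda>(y, z). f y z"] F
    by (simp add: y_def z_def)
  have d\<psi>: "((\<lambda>x. \<psi> (fst_part x)) has_derivative (\<lambda>V. J *v fst_part V)) (at x)"
    using D\<psi> by (intro has_derivative_compose[OF dfst]) (simp add: y_def)
  have dJ: "((\<lambda>x. jacobian \<psi> (at (fst_part x))) has_derivative (\<lambda>V. J' (fst_part V))) (at x)"
    using DJ by (intro has_derivative_compose[OF dfst]) (simp add: y_def)
  \<comment> \<open>the summand \<open>0\<close> and the split into two joins are the shape that the differentiation rules produce\<close>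
  define A where "A V = vec_join (F (fst_part V, snd_part V)) 0 + vec_join 0
      (- (lam *\<^sub>R (snd_part V - J *v fst_part V))
        + (J *v F (fst_part V, snd_part V) + J' (fst_part V) *v f y z) + 0)" for V
  have "((\<lambda>x. vec_join (f (fst_part x) (snd_part x)) 0 + vec_join 0
      (- (lam *\<^sub>R (snd_part x - \<psi> (fst_part x))) + jacobian \<psi> (at (fst_part x)) *v f (fst_part x) (snd_part x) + \<upsilon>))
      has_derivative A) (at x)"
    unfolding A_def[abs_def] J_def y_def z_def
    by (intro has_derivative_add has_derivative_minus has_derivative_diff
        has_derivative_scaleR_right has_derivative_const
        bounded_linear.has_derivative[OF bounded_linear_vec_join_left]
        bounded_linear.has_derivative[OF bounded_linear_vec_join_right]
        D_matvec df dsnd d\<psi>[unfolded J_def y_def] dJ)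
  then have dh: "((\<lambda>x. backstepping_dynamics f \<psi> lam x \<upsilon>) has_derivative A) (at x)"
    by (simp add: backstepping_dynamics_def Let_def vec_join_add)

  have dE: "((\<lambda>x. snd_part X - jacobian \<psi> (at (fst_part x)) *v fst_part X) has_derivative
      (\<lambda>V. 0 - J' (fst_part V) *v fst_part X)) (at x)"
    by (intro has_derivative_diff has_derivative_const
        bounded_linear.has_derivative[OF bounded_bilinear.bounded_linear_left[OF
            bounded_bilinear_matrix_vector_mult]] dJ)
  have dG: "((\<lambda>x. G (fst_part x)) has_derivative (\<lambda>V. G' (fst_part V))) (at x)"
    using G' by (intro has_derivative_compose[OF dfst]) (simp add: y_def)
  obtain D where D: "(backstepping_metric G \<psi> has_derivative D) (at x)"
    using smooth_has_derivative[OF smooth_backstepping_metric[OF _ \<psi>]] G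
    unfolding riemannian_metric_def by blast
  \<comment> \<open>the derivative of the metric enters only through its quadratic form at \<open>X\<close>, which is
      differentiated by its closed formula instead of blockwise\<close>
  have 1: "((\<lambda>x. form (backstepping_metric G \<psi> x) X X) has_derivative (\<lambda>V. form (D V) X X)) (at x)"
    by (rule bounded_linear.has_derivative[OF bounded_linear_form D])
  have 2: "((\<lambda>x. form (backstepping_metric G \<psi> x) X X) has_derivative
      (\<lambda>V. form (G' (fst_part V)) Y Y + (E \<bullet> (0 - J' (fst_part V) *v Y) + (0 - J' (fst_part V) *v Y) \<bullet> E))) (at x)"
    unfolding form_backstepping_metric E_def Y_def
    by (intro has_derivative_add bounded_linear.has_derivative[OF bounded_linear_form dG]
        has_derivative_inner dE)
  have DX: "form (D V) X X = form (G' (fst_part V)) Y Y - 2 * (E \<bullet> (J' (fst_part V) *v Y))" for V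
    using fun_cong[OF has_derivative_unique[OF 1 2], of V] by (simp add: inner_commute)

  have "form (backstepping_metric G \<psi> x) (A X) X
      = form (G y) (F (Y, Z)) Y + (J' Y *v f y z - lam *\<^sub>R E) \<bullet> E"
    unfolding form_backstepping_metric A_def
    by (simp add: vec_join_add E_def Y_def Z_def J_def y_def)
  \<comment> \<open>the variation of the feedback on the left, the derivative of the metric along the flow on the right\<close>
  moreover have "J' Y *v f y z = J' (f y z) *v Y"
    unfolding J'_def by (rule jacobian_derivative_symmetric[OF \<psi>])
  moreover have "fst_part (backstepping_dynamics f \<psi> lam x \<upsilon>) = f y z"
    by (simp add: backstepping_dynamics_def Let_def y_def z_def)
  ultimately have "form (contraction_matrix (backstepping_metric G \<psi>) (backstepping_dynamics f \<psi> lam) x \<upsilon>) X X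
      = 2 * form (G y) (F (Y, Z)) Y + form (G' (f y z)) Y Y - 2 * lam * (E \<bullet> E)"
    by (simp add: form_contraction_matrix[where h = "backstepping_dynamics f \<psi> lam", OF dh D sym(2)]
        DX inner_diff_left inner_diff_right inner_commute right_diff_distrib)
  also have "\<dots> = 2 * form (G y) (F (Y, J *v Y)) Y + form (G' (f y z)) Y Y
      + 2 * form (G y) (F (0, E)) Y - 2 * lam * (E \<bullet> E)"
    by (simp add: Fsum[symmetric] form_def inner_add_left)
  also have "\<dots> = form (contraction_matrix G h y u) Y Y + 2 * form (G y) (jacobian (h y) (at u) *v E) Y
      - 2 * lam * (E \<bullet> E)"
    by (simp add: form_contraction_matrix[where h = h, OF hy G' sym(1)] jacobian_mult[OF hu] hyu)
  finally show ?thesis .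
qed

text \<open>With \<open>b\<^sup>2 < 8 l m\<close> the quadratic form with coefficients \<open>l\<close>, \<open>- b\<close>, \<open>2 m\<close> is positive definite. The rate
  \<open>\<mu>\<close> is its determinant divided by its trace, a lower bound for the smaller eigenvalue: it makes
  \<open>(l - \<mu>) (2 m - \<mu>) = b\<^sup>2 / 4 + \<mu>\<^sup>2\<close>, so the form stays positive after subtracting \<open>\<mu>\<close>.\<close>

lemma cross_term_absorbed:
  fixes l m a b e :: real
  assumes "l > 0" and m: "b\<^sup>2 / (8 * l) < m"
  defines "\<mu> \<equiv> (8 * l * m - b\<^sup>2) / (4 * (2 * m + l))"
  shows "\<mu> > 0" "- l * a\<^sup>2 + b * a * e - 2 * m * e\<^sup>2 \<le> - \<mu> * (a\<^sup>2 + e\<^sup>2)"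
proof -
  have bm: "b\<^sup>2 < 8 * l * m"
    using m \<open>l > 0\<close> by (simp add: divide_less_eq mult_ac)
  then have "l * m > 0"
    using zero_le_power2[of b] by linarith
  then have "m > 0"
    using \<open>l > 0\<close> by (simp add: zero_less_mult_iff)
  show "\<mu> > 0"
    unfolding \<mu>_def using bm \<open>m > 0\<close> \<open>l > 0\<close> by simp
  have *: "\<mu> * (2 * m + l) = 2 * l * m - b\<^sup>2 / 4"
    unfolding \<mu>_def using \<open>m > 0\<close> \<open>l > 0\<close> by (simp add: field_simps)
  have "\<mu> * (2 * m + l) < l * (2 * m + l)"
  proof -
    have "l * (2 * m + l) = 2 * l * m + l * l"
      by (simp add: algebra_simps)
    then show ?thesis
      using * zero_le_power2[of b] mult_pos_pos[OF \<open>l > 0\<close> \<open>l > 0\<close>] by linarith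
  qed
  then have P: "l - \<mu> > 0"
    using \<open>m > 0\<close> \<open>l > 0\<close> by simp
  have "(l - \<mu>) * (2 * m - \<mu>) = b\<^sup>2 / 4 + \<mu>\<^sup>2"
    using * by (simp add: algebra_simps power2_eq_square)
  then have "(l - \<mu>) * ((l - \<mu>) * a\<^sup>2 - b * a * e + (2 * m - \<mu>) * e\<^sup>2)
      = ((l - \<mu>) * a - b * e / 2)\<^sup>2 + \<mu>\<^sup>2 * e\<^sup>2"
    by algebra
  also have "\<dots> \<ge> 0" by simp
  finally have "(l - \<mu>) * a\<^sup>2 - b * a * e + (2 * m - \<mu>) * e\<^sup>2 \<ge> 0"
    using P by (simp add: zero_le_mult_iff)
  then show "- l * a\<^sup>2 + b * a * e - 2 * m * e\<^sup>2 \<le> - \<mu> * (a\<^sup>2 + e\<^sup>2)"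
    by (simp add: algebra_simps)
qed

theorem lemma4p8:
  fixes f :: "real^'p \<Rightarrow> real^'q \<Rightarrow> real^'p"
    and \<psi> :: "real^'p \<Rightarrow> real^'q"
    and G :: "real^'p \<Rightarrow> real^'p^'p"
    and lam_hat \<alpha> :: real
  assumes f_smooth: "smooth_on UNIV (\<lambda>(y, z). f y z)"
    and psi_smooth: "smooth_on UNIV \<psi>"
    and contr: "contraction_metric_with (eta_system f \<psi>) G lam_hat \<alpha>"
  shows "\<forall>lam > \<alpha>\<^sup>2 / (8 * lam_hat).
           contraction_metric (closed_loop (cascade f) UNIV (backstepping_law f \<psi> lam))
             (backstepping_metric G \<psi>)"
proof (intro allI impI)
  fix lam
  assume lam: "\<alpha>\<^sup>2 / (8 * lam_hat) < lam"
  define h where "h y u = f y (\<psi> y + u)" for y u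
  have G: "riemannian_metric G" and "lam_hat > 0"
    and ineq: "\<And>X x Y u. form (contraction_matrix G h x u) X X + 2 * form (G x) (jacobian (h x) (at u) *v Y) X
        \<le> - lam_hat * form (G x) X X + \<alpha> * sqrt (form (G x) X X) * sqrt (form (mat 1) Y Y)"
    using contr
    by (auto simp: contraction_metric_with_def eta_system_def mk_control_sys_def h_def[abs_def])
  define \<mu> where "\<mu> = (8 * lam_hat * lam - \<alpha>\<^sup>2) / (4 * (2 * lam + lam_hat))"
  note cross = cross_term_absorbed[OF \<open>lam_hat > 0\<close> lam, folded \<mu>_def]
  have "form (contraction_matrix (backstepping_metric G \<psi>) (backstepping_dynamics f \<psi> lam) x \<upsilon>) X X
      + 2 * form (backstepping_metric G \<psi> x) (jacobian (\<lambda>\<upsilon>. backstepping_dynamics f \<psi> lam x \<upsilon>) (at \<upsilon>) *v V) X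
      \<le> - \<mu> * form (backstepping_metric G \<psi> x) X X
        + 2 * sqrt (form (backstepping_metric G \<psi> x) X X) * sqrt (form (mat 1) V V)" for x \<upsilon> X V
  proof -
    define y where "y = fst_part x"
    define Y where "Y = fst_part X"
    define E where "E = snd_part X - jacobian \<psi> (at (fst_part x)) *v fst_part X"
    define a where "a = sqrt (form (G y) Y Y)"
    have "form (G y) Y Y \<ge> 0"
      using G by (cases "Y = 0") (auto simp: riemannian_metric_def form_def less_imp_le)
    then have a: "form (G y) Y Y = a\<^sup>2"
      by (simp add: a_def)
    have q: "form (backstepping_metric G \<psi> x) X X = a\<^sup>2 + (norm E)\<^sup>2"
      by (simp add: form_backstepping_metric a[symmetric] E_def Y_def y_def power2_norm_eq_inner)
    have n: "sqrt (form (mat 1) W W) = norm W" for W :: "real^'q"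
      by (simp add: form_def norm_eq_sqrt_inner)
    have "form (contraction_matrix (backstepping_metric G \<psi>) (backstepping_dynamics f \<psi> lam) x \<upsilon>) X X
        = form (contraction_matrix G h y (snd_part x - \<psi> y)) Y Y
          + 2 * form (G y) (jacobian (h y) (at (snd_part x - \<psi> y)) *v E) Y - 2 * lam * (norm E)\<^sup>2"
      using form_contraction_matrix_backstepping[OF f_smooth psi_smooth G, of lam x \<upsilon> X]
      by (simp add: h_def[abs_def] y_def Y_def E_def power2_norm_eq_inner)
    also have "\<dots> \<le> - lam_hat * a\<^sup>2 + \<alpha> * a * norm E - 2 * lam * (norm E)\<^sup>2"
      using ineq[of y "snd_part x - \<psi> y" Y E] by (simp add: n a[symmetric] a_def[symmetric])
    also have "\<dots> \<le> - \<mu> * (a\<^sup>2 + (norm E)\<^sup>2)"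
      by (rule cross(2))
    finally have 1: "form (contraction_matrix (backstepping_metric G \<psi>) (backstepping_dynamics f \<psi> lam) x \<upsilon>) X X
        \<le> - \<mu> * (a\<^sup>2 + (norm E)\<^sup>2)" .
    have zero: "form H 0 W = 0" for H :: "real^'p^'p" and W
      by (simp add: form_def)
    have "form (backstepping_metric G \<psi> x) (jacobian (\<lambda>\<upsilon>. backstepping_dynamics f \<psi> lam x \<upsilon>) (at \<upsilon>) *v V) X
        = V \<bullet> E"
      by (simp add: jacobian_backstepping_input form_backstepping_metric E_def zero)
    also have "\<dots> \<le> norm E * norm V"
      using norm_cauchy_schwarz[of V E] by (simp add: mult.commute)
    also have "\<dots> \<le> sqrt (a\<^sup>2 + (norm E)\<^sup>2) * norm V"
      by (intro mult_right_mono real_le_rsqrt) simp_all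
    finally show ?thesis
      using 1 by (simp add: q n)
  qed
  then have "contraction_metric_with (mk_control_sys UNIV (backstepping_dynamics f \<psi> lam))
      (backstepping_metric G \<psi>) \<mu> 2"
    using smooth_control_system_backstepping[OF f_smooth psi_smooth, of lam]
      riemannian_backstepping_metric[OF G psi_smooth] cross(1)
    by (simp add: contraction_metric_with_def mk_control_sys_def)
  then show "contraction_metric (closed_loop (cascade f) UNIV (backstepping_law f \<psi> lam))
      (backstepping_metric G \<psi>)"
    unfolding closed_loop_backstepping contraction_metric_def by blast
qed

end
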